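(* For all non-negative integers $m$ and $n$, every complex root of the box polynomial $B_{m,n}(x)$ has real part $-n/2$.
   Context: For non-negative integers $m,n$, the box polynomial is $$B_{m,n}(x)=\sum_{\lambda\subseteq m\times n}\ \prod_{i=1}^{m}(x+\lambda_i),$$ where the sum is over all integer sequences (partitions) $\lambda=(n\ge\lambda_1\ge\lambda_2\ge\cdots\ge\lambda_m\ge 0)$, i.e. partitions with $m$ non-negative parts, each at most $n$ (an empty product is $1$). *)

theory Defs
  imports Complex_Main "HOL-Computational_Algebra.Polynomial"
begin

(* The list index starts at 0, so the part lambda_i of the mathematical notation is ls ! (i - 1). *)
definition box_partitions :: "nat \<Rightarrow> nat \<Rightarrow> nat list set" where
  "box_partitions m n = {ls. length ls = m \<and> sorted_wrt (\<ge>) ls \<and> (\<forall>k\<in>set ls. k \<le> n)}"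

definition box_poly :: "nat \<Rightarrow> nat \<Rightarrow> 'a :: comm_semiring_1 poly" where
  "box_poly m n = (\<Sum>ls\<in>box_partitions m n. \<Prod>i<m. [:of_nat (ls ! i), 1:])"

lemma finite_box_partitions: "finite (box_partitions m n)"
proof (rule finite_subset)
  show "box_partitions m n \<subseteq> {ls. set ls \<subseteq> {..n} \<and> length ls = m}"
    by (auto simp: box_partitions_def)
  show "finite {ls. set ls \<subseteq> {..n} \<and> length ls = m}"
    by (rule finite_lists_length_eq) simp
qed

lemma poly_box_poly:
  "poly (box_poly m n) x = (\<Sum>ls\<in>box_partitions m n. \<Prod>i<m. (x + of_nat (ls ! i)))"
  by (simp add: box_poly_def poly_sum poly_prod add.commute)

end

theory Submission
  imports Defs "HOL-Computational_Algebra.Fundamental_Theorem_Algebra"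
begin

text \<open>
  Splitting the box partitions by whether the largest part is maximal, respectively whether the
  smallest part is zero, gives two recurrences whose difference is
  \<open>B\<^bsub>m+1,n\<^esub>(x + 1) - B\<^bsub>m+1,n\<^esub>(x) = (n + 1) B\<^bsub>m,n+1\<^esub>(x)\<close>.
  If all roots of a nonconstant polynomial \<open>p\<close> lie on the line \<open>Re z = c\<close>, then
  \<open>\<bar>p(w + 1)\<bar> = \<bar>p(w)\<bar>\<close> only if \<open>w + 1\<close> and \<open>w\<close> are equidistant from that line, that is
  \<open>Re w = c - 1/2\<close>. Since \<open>B\<^bsub>m,0\<^esub>(x) = x\<^sup>m\<close>, induction on \<open>n\<close> for all \<open>m\<close> simultaneously
  concludes.
\<close>

text \<open>A product over the list itself, rather than over indices, lets \<open>simp\<close>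
  evaluate it on the lists built with \<open>#\<close>, \<open>@\<close> and \<open>map Suc\<close>
  in the two splittings below.\<close>

lemma poly_box_poly_prod_list:
  "poly (box_poly m n) x = (\<Sum>ls\<in>box_partitions m n. \<Prod>k\<leftarrow>ls. x + of_nat k)"
  unfolding poly_box_poly
  by (rule sum.cong)
     (auto simp: box_partitions_def prod.list_conv_set_nth atLeast0LessThan)

lemma poly_box_poly_0_right: "poly (box_poly m 0) x = x ^ m"
proof -
  have "box_partitions m 0 = {replicate m 0}"
    by (auto simp: box_partitions_def sorted_wrt_iff_nth_less intro: replicate_eqI)
  then show ?thesis
    by (simp add: poly_box_poly_prod_list prod_list_replicate)
qed

lemma box_partitions_split_first:
  "box_partitions (Suc m) (Suc n) =
     (#) (Suc n) ` box_partitions m (Suc n) \<union> box_partitions (Suc m) n"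
proof (intro equalityI subsetI)
  fix ls assume ls: "ls \<in> box_partitions (Suc m) (Suc n)"
  then obtain k ks where [simp]: "ls = k # ks"
    by (cases ls) (auto simp: box_partitions_def)
  show "ls \<in> (#) (Suc n) ` box_partitions m (Suc n) \<union> box_partitions (Suc m) n"
    using ls by (cases "k = Suc n") (force simp: box_partitions_def)+
qed (force simp: box_partitions_def)+

lemma box_partitions_split_last:
  "box_partitions (Suc m) (Suc n) =
     (\<lambda>ls. ls @ [0]) ` box_partitions m (Suc n) \<union> map Suc ` box_partitions (Suc m) n"
proof (intro equalityI subsetI)
  fix ls assume ls: "ls \<in> box_partitions (Suc m) (Suc n)"
  then obtain ks k where [simp]: "ls = ks @ [k]"
    by (cases ls rule: rev_cases) (auto simp: box_partitions_def)
  show "ls \<in> (\<lambda>ls. ls @ [0]) ` box_partitions m (Suc n) \<union> map Suc ` box_partitions (Suc m) n"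
  proof (cases "k = 0")
    case True
    then show ?thesis using ls by (force simp: box_partitions_def sorted_wrt_append)
  next
    case False
    \<comment> \<open>The last part \<open>k\<close> is the smallest one, so all parts are positive
      and 1 can be subtracted from each.\<close>
    then have pos: "\<forall>j\<in>set ls. j > 0"
      using ls by (force simp: box_partitions_def sorted_wrt_append)
    then have "ls = map Suc (map (\<lambda>j. j - 1) ls)"
      by (simp add: map_idI)
    moreover have "map (\<lambda>j. j - 1) ls \<in> box_partitions (Suc m) n"
      using ls by (auto simp: box_partitions_def sorted_wrt_append sorted_wrt_map
          intro: diff_le_mono elim: sorted_wrt_mono_rel[rotated])
    ultimately show ?thesis by blast
  qed
qed (force simp: box_partitions_def sorted_wrt_append sorted_wrt_map)+

lemma poly_box_poly_split_first:
  "poly (box_poly (Suc m) (Suc n)) x =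
     (x + of_nat (Suc n)) * poly (box_poly m (Suc n)) x + poly (box_poly (Suc m) n) x"
proof -
  have "(#) (Suc n) ` box_partitions m (Suc n) \<inter> box_partitions (Suc m) n = {}"
    by (auto simp: box_partitions_def)
  then show ?thesis
    by (simp add: poly_box_poly_prod_list box_partitions_split_first finite_box_partitions
        sum.union_disjoint sum.reindex sum_distrib_left)
qed

text \<open>Raising every part by 1 turns each factor \<open>x + j\<close> into
  \<open>(x + 1) + j\<close>, whence the shifted argument; an appended zero part contributes the
  factor \<open>x\<close>.\<close>

lemma poly_box_poly_split_last:
  "poly (box_poly (Suc m) (Suc n)) x =
     x * poly (box_poly m (Suc n)) x + poly (box_poly (Suc m) n) (x + 1)"
proof -
  have "(\<lambda>ls. ls @ [0]) ` box_partitions m (Suc n) \<inter> map Suc ` box_partitions (Suc m) n = {}"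
    by (auto simp: append_eq_map_conv)
  moreover have "inj_on (\<lambda>ls. ls @ [0 :: nat]) A" "inj_on (map Suc) B" for A B
    by (auto intro!: inj_onI dest: map_injective)
  ultimately show ?thesis
    by (simp add: poly_box_poly_prod_list box_partitions_split_last finite_box_partitions
        sum.union_disjoint sum.reindex sum_distrib_left o_def mult.commute add.assoc)
qed

lemma poly_box_poly_diff:
  fixes x :: "'a :: comm_ring_1"
  shows "poly (box_poly (Suc m) n) (x + 1) - poly (box_poly (Suc m) n) x =
     of_nat (Suc n) * poly (box_poly m (Suc n)) x"
  using poly_box_poly_split_first[of m n x] poly_box_poly_split_last[of m n x]
  by (simp add: algebra_simps)

text \<open>At 1 every summand is a positive integer, and the zero partition provides at least one
  summand. This serves to show that box polynomials with \<open>m > 0\<close> are not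
  constant.\<close>

lemma poly_box_poly_1_neq_0:
  "poly (box_poly m n) (1 :: 'a :: {comm_semiring_1, semiring_char_0}) \<noteq> 0"
proof -
  have "poly (box_poly m n) (1 :: 'a) = of_nat (\<Sum>ls\<in>box_partitions m n. \<Prod>i<m. Suc (ls ! i))"
    by (simp add: poly_box_poly)
  moreover have "replicate m 0 \<in> box_partitions m n"
    by (auto simp: box_partitions_def sorted_wrt_iff_nth_less)
  then have "(\<Sum>ls\<in>box_partitions m n. \<Prod>i<m. Suc (ls ! i)) \<noteq> 0"
    by (auto simp: finite_box_partitions)
  ultimately show ?thesis
    by (simp only: of_nat_eq_0_iff) simp
qed

text \<open>By factorization over the roots, \<open>norm (poly p u)\<close> is a positive constant
  times the product of the distances from \<open>u\<close> to the roots, with multiplicity. The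
  degree condition guarantees a root, hence a strict inequality.\<close>

lemma norm_poly_strict_mono:
  fixes p :: "complex poly"
  assumes "degree p > 0"
    and less: "\<And>r. poly p r = 0 \<Longrightarrow> norm (v - r) < norm (w - r)"
  shows "norm (poly p v) < norm (poly p w)"
proof -
  let ?R = "{r. poly p r = 0}"
  have [simp]: "p \<noteq> 0" using assms(1) by auto
  have norm_eq: "norm (poly p u) = norm (lead_coeff p) * (\<Prod>r\<in>?R. norm (u - r) ^ order r p)" for u
    by (subst complex_poly_decompose[symmetric])
       (simp add: poly_prod norm_mult norm_power prod_norm[symmetric])
  have "?R \<noteq> {}"
    using fundamental_theorem_of_algebra[of p] assms(1) by (auto simp: constant_degree)
  then obtain r where r: "r \<in> ?R" by blast
  have "(\<Prod>r\<in>?R. norm (v - r) ^ order r p) < (\<Prod>r\<in>?R. norm (w - r) ^ order r p)"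
  proof (rule prod_mono_strict[OF r])
    show "norm (v - r) ^ order r p < norm (w - r) ^ order r p"
      using r by (auto simp: order_root intro!: power_strict_mono less)
    show "0 < norm (w - s) ^ order s p" if "s \<in> ?R" for s
      using less[of s] that by (intro zero_less_power) (auto intro: le_less_trans[OF norm_ge_zero])
  qed (auto simp: poly_roots_finite intro!: power_mono less_imp_le[OF less])
  then show ?thesis by (simp add: norm_eq)
qed

lemma Re_eq_if_poly_shift_eq:
  fixes p :: "complex poly"
  assumes "degree p > 0"
    and roots: "\<And>r. poly p r = 0 \<Longrightarrow> Re r = c"
    and eq: "poly p (w + 1) = poly p w"
  shows "Re w = c - 1 / 2"
proof -
  \<comment> \<open>The imaginary parts cancel: the squared distances differ by
    \<open>2 * (Re w - Re r) + 1\<close>.\<close>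
  have norm_less_iff: "norm (w - r) < norm (w + 1 - r) \<longleftrightarrow> Re w > Re r - 1 / 2"
    "norm (w + 1 - r) < norm (w - r) \<longleftrightarrow> Re w < Re r - 1 / 2" for r
    by (auto simp: cmod_def power2_eq_square algebra_simps)
  show ?thesis
    using norm_poly_strict_mono[OF assms(1), of w "w + 1"]
      norm_poly_strict_mono[OF assms(1), of "w + 1" w] roots eq
    by (cases "Re w" "c - 1 / 2" rule: linorder_cases) (auto simp: norm_less_iff)
qed

theorem theorem7p1:
  fixes m n :: nat and z :: complex
  assumes "poly (box_poly m n) z = 0"
  shows "Re z = - (real n / 2)"
  using assms
proof (induction n arbitrary: m z)
  case 0
  then show ?case by (simp add: poly_box_poly_0_right)
next
  case (Suc n)
  \<comment> \<open>The induction hypothesis is needed at \<open>Suc m\<close>, which is why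
    \<open>m\<close> is generalized.\<close>
  let ?p = "box_poly (Suc m) n :: complex poly"
  \<comment> \<open>Two distinct values of \<open>?p\<close> rule out that it is constant.\<close>
  have "poly ?p (1 + 1) - poly ?p 1 \<noteq> 0"
    unfolding poly_box_poly_diff using poly_box_poly_1_neq_0[of m "Suc n", where ?'a = complex]
    by (simp del: of_nat_Suc)
  then have "degree ?p > 0"
    by (metis constant_degree constant_def diff_self gr0I)
  moreover have "poly ?p (z + 1) = poly ?p z"
    using poly_box_poly_diff[of m n z] Suc.prems by simp
  ultimately have "Re z = - (real n / 2) - 1 / 2"
    using Suc.IH by (intro Re_eq_if_poly_shift_eq)
  then show ?case by (simp add: field_simps)
qed

end
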